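(* Let $\{Z(t)\}$ be the heat diffusion process on the complete graph $K_N$ with $N$ nodes. The conditional entropy $H(Z(t)\mid Z(0))$ is independent of the choice of the initial distribution $\mathbf{p}(0)$ and, for every $t>0$, is given by $$H(Z(t)\mid Z(0))=\log(N)-\frac{N-1}{N}e^{-Nt}\log\!\left(\frac{1+(N-1)e^{-Nt}}{1-e^{-Nt}}\right)-\frac{N-1}{N}\log\!\left(1-e^{-Nt}\right)-\frac1N\log\!\left(1+(N-1)e^{-Nt}\right).$$
   Context: The combinatorial Laplacian $\mathbf{L}$ of a graph with nodes $v_1,\dots,v_N$ has entries $L_{i,i}=d_i$ (the degree of node $i$), $L_{i,j}=-1$ if $i\neq j$ and $v_i,v_j$ are joined by an edge, and $L_{i,j}=0$ otherwise. Heat diffusion is the continuous-time homogeneous Markov chain on the nodes whose probability vector satisfies $\frac{d}{dt}\mathbf{p}^{\intercal}(t)=-\mathbf{p}^{\intercal}(t)\mathbf{L}$ (diffusion rate equal to 1), so its transition matrix from time $0$ to time $t$ is $\mathbf{T}(0,t)=e^{-t\mathbf{L}}$. The conditional entropy is $H(Z(t)\mid Z(0))=\sum_i p_i(0)H_i(t\mid 0)$, where $p_i(0)$ is the probability that $Z(0)=v_i$ and $H_i(t\mid 0)=-\sum_j T_{i,j}(0,t)\log T_{i,j}(0,t)$. Logarithms are natural and $0\log 0=0$. *)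

theory Defs
  imports "HOL-Probability.Probability" "Graph_Theory.Kuratowski"
begin

text \<open>The components of \<^typ>\<open>real^'n^'n\<close> are taken row first: \<open>A $ i $ j\<close> is \<open>A\<^sub>i\<^sub>j\<close>.\<close>

definition mat_power :: "real^'n^'n \<Rightarrow> nat \<Rightarrow> real^'n^'n" where
  "mat_power A k = (((**) A) ^^ k) (mat 1)"

definition mat_exp :: "real^'n^'n \<Rightarrow> real^'n^'n" where
  "mat_exp A = (\<Sum>k. (1 / fact k) *\<^sub>R mat_power A k)"

lemma mat_power_0 [simp]: "mat_power A 0 = mat 1"
  by (simp add: mat_power_def)

lemma mat_power_Suc: "mat_power A (Suc k) = A ** mat_power A k"
  by (simp add: mat_power_def)

lemma mat_power_Suc': "mat_power A (Suc k) = mat_power A k ** A"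
  by (induction k) (simp_all add: mat_power_Suc matrix_mul_assoc)

lemma mat_power_scaleR: "mat_power (t *\<^sub>R A) k = t ^ k *\<^sub>R mat_power A k"
  by (induction k)
     (simp_all add: mat_power_Suc vec_eq_iff matrix_matrix_mult_def sum_distrib_left mult_ac)

lemma mat_power_bound:
  "\<bar>mat_power A k $ i $ j\<bar> \<le> (\<Sum>i\<in>UNIV. \<Sum>j\<in>UNIV. \<bar>A $ i $ j\<bar>) ^ k" (is "_ \<le> ?c ^ k")
proof (induction k arbitrary: i j)
  case 0
  then show ?case by (simp add: mat_def)
next
  case (Suc k)
  have c: "?c \<ge> 0" by (intro sum_nonneg) auto
  have "\<bar>mat_power A (Suc k) $ i $ j\<bar> \<le> (\<Sum>l\<in>UNIV. \<bar>A $ i $ l * mat_power A k $ l $ j\<bar>)"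
    by (simp add: mat_power_Suc matrix_matrix_mult_def)
  also have "\<dots> \<le> (\<Sum>l\<in>UNIV. \<bar>A $ i $ l\<bar> * ?c ^ k)"
    by (intro sum_mono) (simp add: abs_mult Suc mult_left_mono)
  also have "\<dots> = (\<Sum>l\<in>UNIV. \<bar>A $ i $ l\<bar>) * ?c ^ k"
    by (simp add: sum_distrib_right)
  also have "\<dots> \<le> ?c * ?c ^ k"
    using c by (intro mult_right_mono member_le_sum[of i UNIV "\<lambda>i. \<Sum>l\<in>UNIV. \<bar>A $ i $ l\<bar>"])
      (auto intro: sum_nonneg)
  finally show ?case by simp
qed

lemma mat_exp_summable_entry: "summable (\<lambda>k. mat_power A k $ i $ j / fact k * (x::real) ^ k)"
proof (rule summable_comparison_test')
  let ?c = "\<Sum>i\<in>UNIV. \<Sum>j\<in>UNIV. \<bar>A $ i $ j\<bar>"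
  show "summable (\<lambda>k. inverse (fact k) * (?c * \<bar>x\<bar>) ^ k)"
    by (rule summable_exp)
  show "norm (mat_power A k $ i $ j / fact k * x ^ k) \<le> inverse (fact k) * (?c * \<bar>x\<bar>) ^ k" for k
    using mult_right_mono[OF mat_power_bound[of A k i j], of "\<bar>x\<bar> ^ k"]
    by (simp add: abs_mult power_abs power_mult_distrib field_simps)
qed

lemma mat_exp_scaleR_nth:
  "mat_exp (x *\<^sub>R A) $ i $ j = (\<Sum>k. mat_power A k $ i $ j / fact k * x ^ k)"
proof -
  let ?S = "\<chi> i j. (\<Sum>k. mat_power A k $ i $ j / fact k * x ^ k)"
  have "(\<lambda>k. (1 / fact k) *\<^sub>R mat_power (x *\<^sub>R A) k) sums ?S"
    unfolding sums_def
  proof (intro vec_tendstoI)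
    fix i j
    show "(\<lambda>n. (\<Sum>k<n. (1 / fact k) *\<^sub>R mat_power (x *\<^sub>R A) k) $ i $ j) \<longlonglongrightarrow> ?S $ i $ j"
      using summable_LIMSEQ[OF mat_exp_summable_entry[of A i j x]]
      by (simp add: mat_power_scaleR mult_ac)
  qed
  then show ?thesis by (simp add: mat_exp_def sums_iff)
qed

lemma mat_exp_0 [simp]: "mat_exp 0 = mat 1"
proof -
  have "mat_exp (0 *\<^sub>R (0::real^'n^'n)) = mat 1"
    unfolding vec_eq_iff mat_exp_scaleR_nth powser_zero by simp
  then show ?thesis by simp
qed

lemma has_derivative_mat_exp_entry:
  "((\<lambda>t. mat_exp (t *\<^sub>R A) $ i $ j) has_real_derivative (mat_exp (t *\<^sub>R A) ** A) $ i $ j) (at t)"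
proof -
  have "diffs (\<lambda>k. mat_power A k $ i $ j / fact k) n * t ^ n
        = (\<Sum>l\<in>UNIV. mat_power A n $ i $ l / fact n * t ^ n * A $ l $ j)" for n
    by (simp add: diffs_def mat_power_Suc' matrix_matrix_mult_def sum_distrib_left
        sum_distrib_right sum_divide_distrib divide_simps mult_ac del: of_nat_Suc)
  then have "(\<Sum>n. diffs (\<lambda>k. mat_power A k $ i $ j / fact k) n * t ^ n)
        = (\<Sum>l\<in>UNIV. \<Sum>n. mat_power A n $ i $ l / fact n * t ^ n * A $ l $ j)"
    by (simp only:) (intro suminf_sum summable_mult2 mat_exp_summable_entry)
  also have "\<dots> = (mat_exp (t *\<^sub>R A) ** A) $ i $ j"
    unfolding matrix_matrix_mult_def mat_exp_scaleR_nth vec_lambda_beta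
    by (intro sum.cong refl suminf_mult2[symmetric] mat_exp_summable_entry)
  finally show ?thesis
    using termdiffs_strong_converges_everywhere[of "\<lambda>k. mat_power A k $ i $ j / fact k" t]
      mat_exp_summable_entry[of A i j]
    by (simp add: mat_exp_scaleR_nth)
qed

text \<open>A graph is a symmetric digraph without loops and multiple arcs (locale \<^locale>\<open>graph\<close>), so
  \<^const>\<open>out_degree\<close> is the usual degree. The node set is the whole finite index type.\<close>

definition laplacian :: "('n::finite, 'e) pre_digraph \<Rightarrow> real^'n^'n" where
  "laplacian G = (\<chi> i j. if i = j then real (out_degree G i)
                         else if i \<rightarrow>\<^bsub>G\<^esub> j then - 1 else 0)"

text \<open>\<open>T s t\<close> is the matrix of transition probabilities from time \<open>s\<close> to time \<open>t\<close>. In the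
  Markov property the event on the left prescribes the states at finitely many times up to the
  present time \<open>s\<close>; stating it with products instead of conditional probabilities covers
  conditioning events of probability zero.\<close>

definition markov_chain ::
  "'a measure \<Rightarrow> (real \<Rightarrow> 'a \<Rightarrow> 'n::finite) \<Rightarrow> (real \<Rightarrow> real \<Rightarrow> real^'n^'n) \<Rightarrow> bool" where
  "markov_chain M Z T \<longleftrightarrow>
     prob_space M \<and>
     (\<forall>t\<ge>0. Z t \<in> measurable M (count_space UNIV)) \<and>
     (\<forall>S s t z j. finite S \<longrightarrow> S \<subseteq> {0..s} \<longrightarrow> s \<in> S \<longrightarrow> s \<le> t \<longrightarrow>
        measure M {\<omega> \<in> space M. (\<forall>u\<in>S. Z u \<omega> = z u) \<and> Z t \<omega> = j}
        = measure M {\<omega> \<in> space M. \<forall>u\<in>S. Z u \<omega> = z u} * T s t $ z s $ j)"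

definition heat_transition ::
  "('n::finite, 'e) pre_digraph \<Rightarrow> real \<Rightarrow> real \<Rightarrow> real^'n^'n" where
  "heat_transition G s t = mat_exp (- (t - s) *\<^sub>R laplacian G)"

definition heat_diffusion ::
  "('n::finite, 'e) pre_digraph \<Rightarrow> 'a measure \<Rightarrow> (real \<Rightarrow> 'a \<Rightarrow> 'n) \<Rightarrow> bool" where
  "heat_diffusion G M Z \<longleftrightarrow> graph G \<and> verts G = UNIV \<and> markov_chain M Z (heat_transition G)"

definition law_vec :: "'a measure \<Rightarrow> ('a \<Rightarrow> 'n::finite) \<Rightarrow> real^'n" where
  "law_vec M X = (\<chi> i. measure M {\<omega> \<in> space M. X \<omega> = i})"

lemma law_vec_transition:
  assumes "markov_chain M Z T" "0 \<le> t"
  shows "law_vec M (Z t) = law_vec M (Z 0) v* T 0 t"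
proof -
  interpret prob_space M using assms by (simp add: markov_chain_def)
  have meas [measurable]: "Z s \<in> measurable M (count_space UNIV)" if "s \<ge> 0" for s
    using assms that by (simp add: markov_chain_def)
  have "law_vec M (Z t) $ j = (law_vec M (Z 0) v* T 0 t) $ j" for j
  proof -
    have [measurable]: "Z 0 \<in> measurable M (count_space UNIV)" "Z t \<in> measurable M (count_space UNIV)"
      using assms(2) by (auto intro: meas)
    have "{\<omega> \<in> space M. Z t \<omega> = j} = (\<Union>i. {\<omega> \<in> space M. Z 0 \<omega> = i \<and> Z t \<omega> = j})"
      by auto
    also have "prob \<dots> = (\<Sum>i\<in>UNIV. prob {\<omega> \<in> space M. Z 0 \<omega> = i \<and> Z t \<omega> = j})"
      by (rule finite_measure_finite_Union) (auto simp: disjoint_family_on_def)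
    also have "\<dots> = (\<Sum>i\<in>UNIV. prob {\<omega> \<in> space M. Z 0 \<omega> = i} * T 0 t $ i $ j)"
    proof (rule sum.cong[OF refl])
      fix i
      show "prob {\<omega> \<in> space M. Z 0 \<omega> = i \<and> Z t \<omega> = j} = prob {\<omega> \<in> space M. Z 0 \<omega> = i} * T 0 t $ i $ j"
        using assms(1)[unfolded markov_chain_def, THEN conjunct2, THEN conjunct2, rule_format,
            of "{0}" 0 t "\<lambda>_. i" j] assms(2)
        by simp
    qed
    finally show ?thesis by (simp add: law_vec_def vector_matrix_mult_def mult_ac)
  qed
  then show ?thesis by (simp add: vec_eq_iff)
qed

text \<open>The definition by the matrix exponential agrees with the description by the heat equation.\<close>

lemma heat_equation:
  assumes "heat_diffusion G M Z" "0 \<le> t"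
  shows "((\<lambda>t. law_vec M (Z t)) has_vector_derivative - (law_vec M (Z t) v* laplacian G))
           (at t within {0..})"
proof -
  let ?L = "laplacian G" and ?p = "law_vec M (Z 0)"
  have mc: "markov_chain M Z (heat_transition G)"
    using assms by (simp add: heat_diffusion_def)
  have eq: "law_vec M (Z s) = ?p v* mat_exp (s *\<^sub>R - ?L)" if "s \<ge> 0" for s
    using law_vec_transition[OF mc that] by (simp add: heat_transition_def)
  have "((\<lambda>s. (?p v* mat_exp (s *\<^sub>R - ?L)) $ j) has_real_derivative
          (?p v* (mat_exp (t *\<^sub>R - ?L) ** - ?L)) $ j) (at t within {0..})" for j
    unfolding vector_matrix_mult_def vec_lambda_beta
    by (rule DERIV_sum, (rule DERIV_cmult)?)
       (rule has_field_derivative_at_within[OF has_derivative_mat_exp_entry])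
  moreover have "?p v* (mat_exp (t *\<^sub>R - ?L) ** - ?L) = - (law_vec M (Z t) v* ?L)"
    unfolding eq[OF assms(2)] vector_matrix_mul_assoc[symmetric]
    by (simp add: vec_eq_iff vector_matrix_mult_def sum_negf)
  ultimately have "((\<lambda>s. (?p v* mat_exp (s *\<^sub>R - ?L)) $ j) has_derivative
      (\<lambda>x. x * (- (law_vec M (Z t) v* ?L)) $ j)) (at t within {0..})" for j
    by (simp only: has_field_derivative_def mult_commute_abs)
  then have "((\<lambda>s. ?p v* mat_exp (s *\<^sub>R - ?L)) has_vector_derivative - (law_vec M (Z t) v* ?L))
      (at t within {0..})"
    unfolding has_vector_derivative_def
    by (subst has_derivative_componentwise_within)
       (auto simp: Basis_vec_def inner_axis)
  then show ?thesis
    by (rule has_vector_derivative_transform[rotated 2])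
       (use assms(2) in simp, rule eq, simp)
qed

text \<open>The convention \<open>0 log 0 = 0\<close> holds automatically as a product with \<open>0\<close>.\<close>

definition row_entropy :: "real^'n^'n \<Rightarrow> 'n::finite \<Rightarrow> real" where
  "row_entropy A i = - (\<Sum>j\<in>UNIV. A $ i $ j * ln (A $ i $ j))"

definition cond_entropy ::
  "'a measure \<Rightarrow> (real \<Rightarrow> 'a \<Rightarrow> 'n::finite) \<Rightarrow> (real \<Rightarrow> real \<Rightarrow> real^'n^'n) \<Rightarrow> real \<Rightarrow> real" where
  "cond_entropy M Z T t = (\<Sum>i\<in>UNIV. law_vec M (Z 0) $ i * row_entropy (T 0 t) i)"

end

theory Submission
  imports Defs
begin

text \<open>The Laplacian of \<open>K\<^sub>N\<close> is \<open>L = N I - J\<close>, where \<open>J\<close> is the all-ones matrix, so \<open>L\<^sup>2 = N L\<close>: up to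
  the factor \<open>N\<close> it is the projection onto the vectors orthogonal to the constants. The exponential
  of a matrix with this property is an affine function of the matrix (\<open>mat_exp_quasi_idempotent\<close>),
  which here gives, with \<open>e = exp (- N t)\<close>, the transition probability \<open>(1 + (N - 1) e) / N\<close> of being
  back at the start at time \<open>t\<close> and \<open>(1 - e) / N\<close> for each other node.

  All rows of the transition matrix are thus permutations of one another and have the same entropy.
  The conditional entropy is the average of these row entropies with weights summing to \<open>1\<close>, so it
  is their common value, whatever the initial distribution. Splitting off \<open>ln N\<close> from the logarithms
  of the probabilities, whose sum over a row is \<open>1\<close>, gives the stated formula.\<close>

text \<open>Powers of such a matrix satisfy \<open>A\<^sup>k\<^sup>+\<^sup>1 = c\<^sup>k A\<close>, so only the constant term of the exponential
  series differs from that of \<open>exp (c x) A / c\<close>. The identity is multiplied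
  through by \<open>c\<close>, which makes it trivial for \<open>c = 0\<close>.\<close>

lemma mat_exp_quasi_idempotent:
  fixes A :: "real^'n^'n"
  assumes "A ** A = c *\<^sub>R A"
  shows "c *\<^sub>R mat_exp (x *\<^sub>R A) = c *\<^sub>R mat 1 + (exp (c * x) - 1) *\<^sub>R A"
proof -
  have power: "mat_power A (Suc k) = c ^ k *\<^sub>R A" for k
  proof (induction k)
    case 0
    then show ?case by (simp add: mat_power_Suc)
  next
    case (Suc k)
    have "mat_power A (Suc (Suc k)) = A ** (c ^ k *\<^sub>R A)"
      by (subst mat_power_Suc) (simp only: Suc)
    also have "\<dots> = c ^ k *\<^sub>R (A ** A)"
      by (simp add: vec_eq_iff matrix_matrix_mult_def sum_distrib_left mult_ac)
    finally show ?case by (simp add: assms)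
  qed
  have "c * mat_exp (x *\<^sub>R A) $ i $ j = c * mat 1 $ i $ j + (exp (c * x) - 1) * A $ i $ j" for i j
  proof -
    let ?f = "\<lambda>k. mat_power A k $ i $ j / fact k * x ^ k"
    have "c * ?f k = (if k = 0 then c * mat 1 $ i $ j - A $ i $ j else 0)
                      + A $ i $ j * ((c * x) ^ k /\<^sub>R fact k)" for k
      by (cases k) (simp_all add: power power_mult_distrib divide_simps del: fact_Suc)
    moreover have "(\<lambda>k. (if k = 0 then c * mat 1 $ i $ j - A $ i $ j else 0)
          + A $ i $ j * ((c * x) ^ k /\<^sub>R fact k)) sums
        ((c * mat 1 $ i $ j - A $ i $ j) + A $ i $ j * exp (c * x))"
      using sums_single[of 0 "\<lambda>_. c * mat 1 $ i $ j - A $ i $ j"]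
      by (intro sums_add sums_mult exp_converges) simp
    ultimately have "(\<lambda>k. c * ?f k) sums
        ((c * mat 1 $ i $ j - A $ i $ j) + A $ i $ j * exp (c * x))"
      by simp
    moreover have "(\<lambda>k. c * ?f k) sums (c * mat_exp (x *\<^sub>R A) $ i $ j)"
      unfolding mat_exp_scaleR_nth
      by (intro sums_mult summable_sums mat_exp_summable_entry)
    ultimately show ?thesis
      by (auto dest: sums_unique2 simp: algebra_simps)
  qed
  then show ?thesis by (simp add: vec_eq_iff)
qed

lemma complete_digraph_out_degree:
  assumes "K\<^bsub>n\<^esub> G" "v \<in> verts G"
  shows "out_degree G v = n - 1"
proof -
  interpret graph G using assms by (simp add: complete_digraph_def)
  have "arc_to_ends G ` out_arcs G v = {p \<in> arcs_ends G. fst p = v}"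
    by (auto simp: out_arcs_def arcs_ends_def arc_to_ends_def)
  also have "\<dots> = Pair v ` (verts G - {v})"
    using assms by (auto simp: complete_digraph_def)
  finally have "card (arc_to_ends G ` out_arcs G v) = card (verts G - {v})"
    by (simp add: card_image inj_on_def)
  \<comment> \<open>A node is counted once as a neighbour because there are no multiple arcs.\<close>
  moreover have "inj_on (arc_to_ends G) (out_arcs G v)"
    by (rule inj_on_subset[OF inj_on_arc_to_ends]) (auto simp: out_arcs_def)
  ultimately show ?thesis
    using assms by (simp add: card_image out_degree_def complete_digraph_def)
qed

lemma laplacian_complete:
  fixes G :: "('n::finite, 'e) pre_digraph"
  assumes "K\<^bsub>CARD('n)\<^esub> G" "verts G = UNIV"
  shows "laplacian G = (\<chi> i j. (if i = j then real CARD('n) else 0) - 1)"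
  using assms(1) by (simp add: vec_eq_iff laplacian_def complete_digraph_out_degree[OF assms(1)]
    assms(2) complete_digraph_def of_nat_diff Suc_leI)

lemma laplacian_complete_quasi_idempotent:
  fixes G :: "('n::finite, 'e) pre_digraph"
  assumes "K\<^bsub>CARD('n)\<^esub> G" "verts G = UNIV"
  shows "laplacian G ** laplacian G = real CARD('n) *\<^sub>R laplacian G"
  by (simp add: laplacian_complete[OF assms] vec_eq_iff matrix_matrix_mult_def left_diff_distrib
    right_diff_distrib sum_subtractf if_distrib[of "\<lambda>x. x * _"] sum.delta sum.delta' cong: if_cong)

lemma heat_transition_complete:
  fixes G :: "('n::finite, 'e) pre_digraph"
  assumes "K\<^bsub>CARD('n)\<^esub> G" "verts G = UNIV"
  defines "N \<equiv> real CARD('n)"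
  shows "heat_transition G s t $ i $ j =
    (if i = j then (1 + (N - 1) * exp (- N * (t - s))) / N else (1 - exp (- N * (t - s))) / N)"
proof -
  have "N * heat_transition G s t $ i $ j
      = N * mat 1 $ i $ j + (exp (- N * (t - s)) - 1) * laplacian G $ i $ j"
    using arg_cong[OF mat_exp_quasi_idempotent[OF laplacian_complete_quasi_idempotent[OF assms(1,2)],
        of "- (t - s)"], of "\<lambda>A. A $ i $ j"]
    by (simp add: N_def heat_transition_def algebra_simps)
  moreover have "N > 0" by (simp add: N_def)
  ultimately show ?thesis
    by (auto simp: laplacian_complete[OF assms(1,2)] mat_def N_def field_simps)
qed

lemma (in prob_space) sum_law_vec:
  assumes [measurable]: "X \<in> measurable M (count_space (UNIV :: 'n::finite set))"
  shows "(\<Sum>i\<in>UNIV. law_vec M X $ i) = 1"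
proof -
  have "(\<Sum>i\<in>UNIV. law_vec M X $ i) = prob (\<Union>i. {\<omega> \<in> space M. X \<omega> = i})"
    unfolding law_vec_def vec_lambda_beta
    by (rule finite_measure_finite_Union[symmetric]) (auto simp: disjoint_family_on_def)
  also have "(\<Union>i. {\<omega> \<in> space M. X \<omega> = i}) = space M" by auto
  finally show ?thesis by (simp add: prob_space)
qed

lemma cond_entropy_const_rows:
  assumes "markov_chain M Z T" "\<And>i. row_entropy (T 0 t) i = h"
  shows "cond_entropy M Z T t = h"
proof -
  interpret prob_space M using assms(1) by (simp add: markov_chain_def)
  have "(\<Sum>i\<in>UNIV. law_vec M (Z 0) $ i) = 1"
    using assms(1) by (intro sum_law_vec) (simp add: markov_chain_def)
  then show ?thesis
    by (simp add: cond_entropy_def assms(2) flip: sum_distrib_right)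
qed

lemma row_entropy_diag_offdiag:
  fixes A :: "real^'n^'n"
  assumes "\<And>i j. A $ i $ j = (if i = j then a else b)"
  shows "row_entropy A i = - (a * ln a) - (real CARD('n) - 1) * (b * ln b)"
proof -
  have "(\<Sum>j\<in>UNIV. A $ i $ j * ln (A $ i $ j)) = a * ln a + (\<Sum>j\<in>UNIV - {i}. b * ln b)"
    by (subst sum.remove[of _ i]) (auto simp: assms intro!: sum.cong)
  then show ?thesis
    by (simp add: row_entropy_def of_nat_diff Suc_leI)
qed

theorem corollary3p6:
  fixes G :: "('n::finite, 'e) pre_digraph" and N :: nat
    and M :: "'a measure" and Z :: "real \<Rightarrow> 'a \<Rightarrow> 'n"
  assumes "N = CARD('n)" and "K\<^bsub>N\<^esub> G" and "heat_diffusion G M Z"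
  shows "(\<forall>(M' :: 'b measure) Z' t. heat_diffusion G M' Z' \<longrightarrow> t \<ge> 0 \<longrightarrow>
            cond_entropy M Z (heat_transition G) t = cond_entropy M' Z' (heat_transition G) t) \<and>
         (\<forall>t>0. cond_entropy M Z (heat_transition G) t
            = ln (real N)
              - (real N - 1) / real N * exp (- real N * t)
                * ln ((1 + (real N - 1) * exp (- real N * t)) / (1 - exp (- real N * t)))
              - (real N - 1) / real N * ln (1 - exp (- real N * t))
              - 1 / real N * ln (1 + (real N - 1) * exp (- real N * t)))"
proof -
  have K: "K\<^bsub>CARD('n)\<^esub> G" "verts G = UNIV"
    using assms by (simp_all add: heat_diffusion_def)
  define a b where "a t = 1 + (real N - 1) * exp (- real N * t)"
    and "b t = 1 - exp (- real N * t)" for t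
  define h where "h t = - (a t / N * ln (a t / N)) - (real N - 1) * (b t / N * ln (b t / N))" for t
  have row: "row_entropy (heat_transition G 0 t) i = h t" for t i
    unfolding h_def using row_entropy_diag_offdiag[of "heat_transition G 0 t" "a t / N" "b t / N" i]
    by (simp add: heat_transition_complete[OF K] a_def b_def assms(1))
  have entropy: "cond_entropy M' Z' (heat_transition G) t = h t"
    if "heat_diffusion G M' Z'" for M' :: "'c measure" and Z' t
    using that row by (intro cond_entropy_const_rows) (simp_all add: heat_diffusion_def)
  have "h t = ln (real N) - (real N - 1) / real N * exp (- real N * t) * ln (a t / b t)
      - (real N - 1) / real N * ln (b t) - 1 / real N * ln (a t)" if "t > 0" for t
  proof -
    have N: "real N \<ge> 1" using assms(1) by (simp add: Suc_leI)
    have pos: "a t > 0" "b t > 0"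
      using N that by (auto simp: a_def b_def intro!: add_pos_nonneg)
    \<comment> \<open>The row sums to one; this collects the \<open>ln N\<close> terms.\<close>
    have "a t + (real N - 1) * b t = N" by (simp add: a_def b_def algebra_simps)
    moreover have "h t = (a t + (real N - 1) * b t) / N * ln N
        - a t / N * ln (a t) - (real N - 1) * (b t / N) * ln (b t)"
      using N pos by (simp add: h_def ln_div field_simps)
    ultimately have "h t = ln N - a t / N * ln (a t) - (real N - 1) * (b t / N) * ln (b t)"
      using N by simp
    then show ?thesis
      using N pos by (simp add: ln_div) (simp add: a_def b_def field_simps)
  qed
  then show ?thesis
    using entropy[OF assms(3)] entropy unfolding a_def b_def by metis
qed

end
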